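(* Consider the bilinear maps $\varphi_{j,k},\psi_j: NF^n\times NF^n\to NF^n$ given as follows (values on pairs of basis elements that are not listed are zero). For $1\le j\le n$ and $2\le k\le n$: $$\varphi_{j,k}(x_j,x_1)=x_k .$$ For $1\le j\le n-1$: $$\psi_j(x_j,x_1)=x_1,\qquad \psi_j(x_i,x_{j+1})=-x_{i+1}\quad (1\le i\le n-1).$$ Then the maps $\varphi_{j,k}$ ($1\le j\le n$, $2\le k\le n$) together with $\psi_j$ ($1\le j\le n-1$) form a basis of $ZL^2(NF^n,NF^n)$.
   Context: $F$ is a field of characteristic zero. $NF^n$ (the null-filiform Leibniz algebra) is the $n$-dimensional $F$-algebra with basis $x_1,\dots,x_n$ and products $[x_i,x_1]=x_{i+1}$ for $1\le i\le n-1$, all other products of basis elements being zero. For a (right) Leibniz algebra $L$, i.e. an algebra with $[x,[y,z]]=[[x,y],z]-[[x,z],y]$, the space $ZL^2(L,L)$ of 2-cocycles (infinitesimal deformations) consists of the bilinear maps $\varphi:L\times L\to L$ such that for all $x,y,z\in L$ $$[x,\varphi(y,z)]-[\varphi(x,y),z]+[\varphi(x,z),y]+\varphi(x,[y,z])-\varphi([x,y],z)+\varphi([x,z],y)=0.$$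
   Formalization: The formal theorem assumes n ≥ 2; for n = 1 the claim fails, since NF^1 has zero product and ZL^2(NF^1,NF^1) is one-dimensional while the listed family of maps is empty. *)

theory Defs
  imports Complex_Main "HOL-Library.Function_Algebras"
begin

text \<open>Bilinear maps \<open>V \<times> V \<rightarrow> V\<close> are curried functions. The type of all functions
  \<open>V \<Rightarrow> V \<Rightarrow> V\<close> is a vector space under the pointwise addition from \<^theory>\<open>HOL-Library.Function_Algebras\<close>
  and the following pointwise scaling.\<close>

definition map_scale :: "('f \<Rightarrow> 'v \<Rightarrow> 'v) \<Rightarrow> 'f \<Rightarrow> ('v \<Rightarrow> 'v \<Rightarrow> 'v) \<Rightarrow> 'v \<Rightarrow> 'v \<Rightarrow> 'v"
  where "map_scale scale c \<phi> = (\<lambda>u v. scale c (\<phi> u v))"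

lemma vector_space_map_scale:
  assumes "vector_space scale"
  shows "vector_space (map_scale scale)"
proof -
  interpret vector_space scale by fact
  show ?thesis
    by unfold_locales
      (simp_all add: map_scale_def fun_eq_iff scale_right_distrib scale_left_distrib)
qed

definition bilinear_map :: "('f::field \<Rightarrow> 'v::ab_group_add \<Rightarrow> 'v) \<Rightarrow> ('v \<Rightarrow> 'v \<Rightarrow> 'v) \<Rightarrow> bool"
  where "bilinear_map scale \<phi> \<longleftrightarrow>
    (\<forall>u. Vector_Spaces.linear scale scale (\<lambda>v. \<phi> u v)) \<and>
    (\<forall>v. Vector_Spaces.linear scale scale (\<lambda>u. \<phi> u v))"

locale leibniz_algebra = vector_space scale
  for scale :: "'f::field \<Rightarrow> 'v::ab_group_add \<Rightarrow> 'v" +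
  fixes br :: "'v \<Rightarrow> 'v \<Rightarrow> 'v"
  assumes bilinear_br: "bilinear_map scale br"
    and leibniz: "br u (br v w) = br (br u v) w - br (br u w) v"

definition ZL2 :: "('f::field \<Rightarrow> 'v::ab_group_add \<Rightarrow> 'v) \<Rightarrow> ('v \<Rightarrow> 'v \<Rightarrow> 'v) \<Rightarrow> ('v \<Rightarrow> 'v \<Rightarrow> 'v) set"
  where "ZL2 scale br = {\<phi>. bilinear_map scale \<phi> \<and>
    (\<forall>u v w. br u (\<phi> v w) - br (\<phi> u v) w + br (\<phi> u w) v
      + \<phi> u (br v w) - \<phi> (br u v) w + \<phi> (br u w) v = 0)}"

text \<open>The null-filiform algebra: the whole type \<^typ>\<open>'v\<close> is the underlying space, and
  \<open>x 1, \<dots>, x n\<close> is its distinguished basis (values of \<open>x\<close> outside \<open>{1..n}\<close> are irrelevant).\<close>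

locale null_filiform = finite_dimensional_vector_space scale "x ` {1..n}"
  for scale :: "'f::field \<Rightarrow> 'v::ab_group_add \<Rightarrow> 'v" and x :: "nat \<Rightarrow> 'v" and n :: nat +
  fixes br :: "'v \<Rightarrow> 'v \<Rightarrow> 'v"
  assumes inj_x: "inj_on x {1..n}"
    and bilinear_br: "bilinear_map scale br"
    and br_x_1: "\<And>i. 1 \<le> i \<Longrightarrow> i \<le> n - 1 \<Longrightarrow> br (x i) (x 1) = x (i + 1)"
    and br_x_other: "\<And>i j. i \<in> {1..n} \<Longrightarrow> j \<in> {1..n} \<Longrightarrow> \<not> (i \<le> n - 1 \<and> j = 1) \<Longrightarrow>
      br (x i) (x j) = 0"

text \<open>The bilinear map whose value at \<open>(x i, x m)\<close> is \<open>t i m\<close>.\<close>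

definition bilinear_ext ::
    "('f::field \<Rightarrow> 'v::ab_group_add \<Rightarrow> 'v) \<Rightarrow> (nat \<Rightarrow> 'v) \<Rightarrow> nat \<Rightarrow> (nat \<Rightarrow> nat \<Rightarrow> 'v) \<Rightarrow> 'v \<Rightarrow> 'v \<Rightarrow> 'v"
  where "bilinear_ext scale x n t = (\<lambda>u v. \<Sum>i=1..n. \<Sum>m=1..n.
    scale (module.representation scale (x ` {1..n}) u (x i) *
           module.representation scale (x ` {1..n}) v (x m)) (t i m))"

definition phi ::
    "('f::field \<Rightarrow> 'v::ab_group_add \<Rightarrow> 'v) \<Rightarrow> (nat \<Rightarrow> 'v) \<Rightarrow> nat \<Rightarrow> nat \<Rightarrow> nat \<Rightarrow> 'v \<Rightarrow> 'v \<Rightarrow> 'v"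
  where "phi scale x n j k =
    bilinear_ext scale x n (\<lambda>i m. if i = j \<and> m = 1 then x k else 0)"

definition psi ::
    "('f::field \<Rightarrow> 'v::ab_group_add \<Rightarrow> 'v) \<Rightarrow> (nat \<Rightarrow> 'v) \<Rightarrow> nat \<Rightarrow> nat \<Rightarrow> 'v \<Rightarrow> 'v \<Rightarrow> 'v"
  where "psi scale x n j =
    bilinear_ext scale x n (\<lambda>i m.
      if i = j \<and> m = 1 then x 1
      else if 1 \<le> i \<and> i \<le> n - 1 \<and> m = j + 1 then - x (i + 1)
      else 0)"

text \<open>An indexed family is a basis of a subset \<open>S\<close> of a vector space; injectivity excludes repeated
  members, which the image set alone would not detect.\<close>

definition family_basis ::
    "('f::field \<Rightarrow> 'w::ab_group_add \<Rightarrow> 'w) \<Rightarrow> 'i set \<Rightarrow> ('i \<Rightarrow> 'w) \<Rightarrow> 'w set \<Rightarrow> bool"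
  where "family_basis scale I b S \<longleftrightarrow>
    inj_on b I \<and> \<not> module.dependent scale (b ` I) \<and> module.span scale (b ` I) = S"


lemma bilinear_mapI:
  assumes "vector_space scale"
    and "\<And>u v w. \<phi> u (v + w) = \<phi> u v + \<phi> u w" "\<And>u v w. \<phi> (u + v) w = \<phi> u w + \<phi> v w"
    and "\<And>c u v. \<phi> u (scale c v) = scale c (\<phi> u v)" "\<And>c u v. \<phi> (scale c u) v = scale c (\<phi> u v)"
  shows "bilinear_map scale \<phi>"
  unfolding bilinear_map_def Vector_Spaces.linear_iff using assms by simp

lemma bilinear_mapD:
  assumes "bilinear_map scale \<phi>"
  shows "\<phi> u (v + w) = \<phi> u v + \<phi> u w" "\<phi> (u + v) w = \<phi> u w + \<phi> v w"
    and "\<phi> u (scale c v) = scale c (\<phi> u v)" "\<phi> (scale c u) v = scale c (\<phi> u v)"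
proof -
  interpret l: Vector_Spaces.linear scale scale "\<lambda>v. \<phi> u v"
    using assms by (simp add: bilinear_map_def)
  interpret r: Vector_Spaces.linear scale scale "\<lambda>u. \<phi> u v" for v
    using assms by (simp add: bilinear_map_def)
  show "\<phi> u (v + w) = \<phi> u v + \<phi> u w" "\<phi> u (scale c v) = scale c (\<phi> u v)"
    by (fact l.add l.scale)+
  show "\<phi> (u + v) w = \<phi> u w + \<phi> v w" "\<phi> (scale c u) v = scale c (\<phi> u v)"
    by (fact r.add r.scale)+
qed

context null_filiform
begin

lemma representation_x:
  assumes "i \<in> {1..n}" "j \<in> {1..n}"
  shows "representation (x ` {1..n}) (x i) (x j) = (if i = j then 1 else 0)"
  using assms inj_x representation_basis[OF independent_Basis, of "x i"]
  by (auto simp: inj_on_eq_iff)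

lemma bilinear_map_bilinear_ext: "bilinear_map scale (bilinear_ext scale x n t)"
  by (rule bilinear_mapI[OF vector_space_axioms])
    (simp_all add: bilinear_ext_def representation_add representation_scale independent_Basis
      span_Basis distrib_left distrib_right scale_left_distrib sum.distrib scale_sum_right
      mult.assoc mult.left_commute del: One_nat_def)

lemma bilinear_ext_x:
  assumes "i \<in> {1..n}" "m \<in> {1..n}"
  shows "bilinear_ext scale x n t (x i) (x m) = t i m"
proof -
  have "bilinear_ext scale x n t (x i) (x m)
      = (\<Sum>i'=1..n. \<Sum>m'=1..n. if m = m' then if i = i' then t i m else 0 else 0)"
    unfolding bilinear_ext_def
    by (intro sum.cong refl) (use assms in \<open>simp add: representation_x del: One_nat_def\<close>)
  also have "\<dots> = t i m"
    using assms by simp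
  finally show ?thesis .
qed

lemma linear_br: "Vector_Spaces.linear scale scale (br u)" "Vector_Spaces.linear scale scale (\<lambda>u. br u v)"
  using bilinear_br by (auto simp: bilinear_map_def eta_contract_eq)

lemma linear_zero_on_basis:
  assumes "Vector_Spaces.linear scale scale f" "\<And>i. i \<in> {1..n} \<Longrightarrow> f (x i) = 0"
  shows "f v = 0"
proof -
  interpret f: Vector_Spaces.linear scale scale f by fact
  have "v \<in> span (x ` {1..n})"
    using span_Basis by blast
  then show ?thesis
    by (rule f.eq_0_on_span[rotated]) (use assms(2) in auto)
qed

lemma linear_br_br:
  "Vector_Spaces.linear scale scale (\<lambda>w. br u (br v w))"
  "Vector_Spaces.linear scale scale (\<lambda>v. br u (br v w))"
  "Vector_Spaces.linear scale scale (\<lambda>v. br (br u v) w)"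
  using Vector_Spaces.linear_compose[OF linear_br(1) linear_br(1)]
    Vector_Spaces.linear_compose[OF linear_br(2) linear_br(1)]
    Vector_Spaces.linear_compose[OF linear_br(1) linear_br(2)]
  by (auto simp: o_def)

lemma br_x_ge_2: "m \<in> {2..n} \<Longrightarrow> br u (x m) = 0"
  by (rule linear_zero_on_basis[OF linear_br(2)]) (auto intro: br_x_other)

lemma br_zero: "br u 0 = 0" "br 0 u = 0"
  using bilinear_mapD(1)[OF bilinear_br, of u 0 0] bilinear_mapD(2)[OF bilinear_br, of 0 0 u]
  by simp_all

lemma br_br_zero: "br u (br v w) = 0"
proof (rule linear_zero_on_basis[OF linear_br_br(1)])
  fix j assume j: "j \<in> {1..n}"
  show "br u (br v (x j)) = 0"
  proof (rule linear_zero_on_basis[OF linear_br_br(2)])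
    fix i assume i: "i \<in> {1..n}"
    show "br u (br (x i) (x j)) = 0"
    proof (cases "i \<le> n - 1 \<and> j = 1")
      case True
      then have "br (x i) (x j) = x (i + 1)" "i + 1 \<in> {2..n}"
        using i br_x_1[of i] by auto
      then show ?thesis
        by (simp add: br_x_ge_2)
    next
      case False
      then show ?thesis
        using br_x_other[OF i j] by (simp add: br_zero)
    qed
  qed
qed

lemma br_br_swap: "br (br u v) w = br (br u w) v"
proof -
  have lin: "Vector_Spaces.linear scale scale (\<lambda>v. br (br u v) w - br (br u w) v)" for w
  proof -
    interpret vector_space_pair scale scale ..
    show ?thesis
      by (rule linear_compose_sub[OF linear_br_br(3) linear_br(1)])
  qed
  have lin': "Vector_Spaces.linear scale scale (\<lambda>w. br (br u v) w - br (br u w) v)" for v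
  proof -
    interpret vector_space_pair scale scale ..
    show ?thesis
      by (rule linear_compose_sub[OF linear_br(1) linear_br_br(3)])
  qed
  have "br (br u v) w - br (br u w) v = 0"
  proof (rule linear_zero_on_basis[OF lin])
    fix i assume i: "i \<in> {1..n}"
    show "br (br u (x i)) w - br (br u w) (x i) = 0"
    proof (rule linear_zero_on_basis[OF lin'])
      fix j assume j: "j \<in> {1..n}"
      consider "i = j" | "i \<in> {2..n}" | "j \<in> {2..n}" using i j by fastforce
      then show "br (br u (x i)) (x j) - br (br u (x j)) (x i) = 0"
        by cases (auto simp: br_x_ge_2 br_zero)
    qed
  qed
  then show ?thesis by simp
qed

sublocale leibniz_algebra scale br
  by unfold_locales (use bilinear_br br_br_zero br_br_swap in auto)

end

end

theory Submission
  imports Defs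
begin

text \<open>Write \<open>N\<close> for right multiplication by \<open>x 1\<close> and \<open>c\<close> for the coordinate at \<open>x 1\<close>, so that
  \<open>[u, v] = c(v) N u\<close>. Evaluating the cocycle identity at \<open>(u, x 1, x 1)\<close>, and adding its values at
  \<open>(u, x 1, x m)\<close> and \<open>(u, x m, x 1)\<close>, expresses \<open>\<phi>(u, x (m + 1))\<close> through the values
  \<open>\<phi>(v, x 1)\<close> and forces \<open>c(\<phi>(x n, x 1)) = 0\<close>. Hence a cocycle is determined by the remaining
  coordinates of the \<open>\<phi>(x j, x 1)\<close>, and these coordinates are dual to the family of the
  \<open>\<phi>\<^sub>j\<^sub>,\<^sub>k\<close> and \<open>\<psi>\<^sub>j\<close>.\<close>

section \<open>Bases from dual functionals\<close>

text \<open>Applying \<open>\<delta> i\<close> to a linear combination of the \<open>b j\<close>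
  returns its \<open>i\<close>-th coefficient, which gives independence. For spanning, subtracting
  from \<open>v\<close> the combination with coefficients \<open>\<delta> j v\<close> leaves an
  element of \<open>S\<close> killed by all \<open>\<delta> i\<close>, so it is 0. No dimension of
  \<open>S\<close> has to be known beforehand.\<close>

lemma family_basis_dual:
  fixes scale :: "'f::field \<Rightarrow> 'w::ab_group_add \<Rightarrow> 'w"
  assumes "vector_space scale" "finite I"
    and S: "module.subspace scale S" "\<And>i. i \<in> I \<Longrightarrow> b i \<in> S"
    and lin: "\<And>i. i \<in> I \<Longrightarrow> Vector_Spaces.linear scale (*) (\<delta> i)"
    and dual: "\<And>i j. i \<in> I \<Longrightarrow> j \<in> I \<Longrightarrow> \<delta> i (b j) = (if i = j then 1 else 0)"
    and kernel: "\<And>v. v \<in> S \<Longrightarrow> (\<And>i. i \<in> I \<Longrightarrow> \<delta> i v = 0) \<Longrightarrow> v = 0"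
  shows "family_basis scale I b S"
proof -
  interpret vector_space scale by fact
  have \<delta>_comb: "\<delta> i (\<Sum>j\<in>I. scale (a j) (b j)) = a i" if "i \<in> I" for i a
  proof -
    interpret d: Vector_Spaces.linear scale "(*)" "\<delta> i" using lin that .
    have "\<delta> i (\<Sum>j\<in>I. scale (a j) (b j)) = (\<Sum>j\<in>I. if i = j then a j else 0)"
      unfolding d.sum d.scale by (intro sum.cong refl) (simp add: dual that)
    then show ?thesis using that \<open>finite I\<close> by simp
  qed
  have inj: "inj_on b I"
  proof (rule inj_onI)
    fix i j assume "i \<in> I" "j \<in> I" "b i = b j"
    then show "i = j" using dual[of i i] dual[of i j] by (simp split: if_splits)
  qed
  have "independent (b ` I)"
  proof (rule independent_if_scalars_zero)
    fix f v assume f: "(\<Sum>v\<in>b ` I. scale (f v) v) = 0" and "v \<in> b ` I"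
    then obtain i where i: "i \<in> I" "v = b i" by blast
    interpret d: Vector_Spaces.linear scale "(*)" "\<delta> i" using lin i(1) .
    have "(\<Sum>j\<in>I. scale (f (b j)) (b j)) = 0"
      using f by (simp add: sum.reindex[OF inj])
    then show "f v = 0"
      using \<delta>_comb[OF i(1), of "\<lambda>j. f (b j)"] i(2) by (simp add: d.zero)
  qed (use \<open>finite I\<close> in simp)
  moreover have "span (b ` I) = S"
  proof
    show "span (b ` I) \<subseteq> S" using S by (intro span_minimal) auto
    show "S \<subseteq> span (b ` I)"
    proof
      fix v assume v: "v \<in> S"
      let ?w = "\<Sum>j\<in>I. scale (\<delta> j v) (b j)"
      have "v - ?w = 0"
      proof (rule kernel)
        show "v - ?w \<in> S"
          by (intro subspace_diff subspace_sum subspace_scale S v)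
        fix i assume i: "i \<in> I"
        interpret d: Vector_Spaces.linear scale "(*)" "\<delta> i" using lin i .
        show "\<delta> i (v - ?w) = 0" by (simp add: d.diff \<delta>_comb i)
      qed
      moreover have "?w \<in> span (b ` I)"
        by (intro span_sum span_scale span_base) blast
      ultimately show "v \<in> span (b ` I)" by simp
    qed
  qed
  ultimately show ?thesis using inj by (simp add: family_basis_def)
qed

section \<open>Coordinates and the bracket in coordinate form\<close>

context null_filiform
begin

declare One_nat_def [simp del]

abbreviation coord :: "nat \<Rightarrow> 'v \<Rightarrow> 'f"
  where "coord i u \<equiv> representation (x ` {1..n}) u (x i)"

lemma coord_add: "coord i (u + v) = coord i u + coord i v"
  by (simp add: representation_add independent_Basis span_Basis)

lemma coord_scale: "coord i (scale a u) = a * coord i u"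
  by (simp add: representation_scale independent_Basis span_Basis)

lemma coord_diff: "coord i (u - v) = coord i u - coord i v"
  by (simp add: representation_diff independent_Basis span_Basis)

lemma coord_zero: "coord i 0 = 0"
  using coord_scale[where i = i and a = 0 and u = 0] by simp

lemma eq_0_if_coords_0:
  assumes "\<And>i. i \<in> {1..n} \<Longrightarrow> coord i u = 0"
  shows "u = 0"
proof -
  have "u = (\<Sum>b\<in>x ` {1..n}. scale (representation (x ` {1..n}) u b) b)"
    using sum_representation_eq[OF independent_Basis, of u "x ` {1..n}"]
    by (simp add: span_Basis)
  also have "\<dots> = 0"
    using assms by (intro sum.neutral) auto
  finally show ?thesis .
qed

lemma linear_eq_on_basis:
  assumes "Vector_Spaces.linear scale scale f" "Vector_Spaces.linear scale scale g"
    and "\<And>i. i \<in> {1..n} \<Longrightarrow> f (x i) = g (x i)"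
  shows "f v = g v"
proof -
  interpret vector_space_pair scale scale ..
  have "f v - g v = 0"
    by (rule linear_zero_on_basis[OF linear_compose_sub[OF assms(1,2)]]) (use assms(3) in simp)
  then show ?thesis by simp
qed

lemma bilinear_eq_on_basis:
  assumes \<phi>: "bilinear_map scale \<phi>" and \<psi>: "bilinear_map scale \<psi>"
    and eq: "\<And>i m. i \<in> {1..n} \<Longrightarrow> m \<in> {1..n} \<Longrightarrow> \<phi> (x i) (x m) = \<psi> (x i) (x m)"
  shows "\<phi> u v = \<psi> u v"
proof (rule linear_eq_on_basis[where f = "\<lambda>u. \<phi> u v" and g = "\<lambda>u. \<psi> u v"])
  show "Vector_Spaces.linear scale scale (\<lambda>u. \<phi> u v)"
    "Vector_Spaces.linear scale scale (\<lambda>u. \<psi> u v)"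
    using \<phi> \<psi> by (simp_all add: bilinear_map_def)
  fix i assume i: "i \<in> {1..n}"
  show "\<phi> (x i) v = \<psi> (x i) v"
  proof (rule linear_eq_on_basis[where f = "\<lambda>v. \<phi> (x i) v" and g = "\<lambda>v. \<psi> (x i) v"])
    show "Vector_Spaces.linear scale scale (\<lambda>v. \<phi> (x i) v)"
      "Vector_Spaces.linear scale scale (\<lambda>v. \<psi> (x i) v)"
      using \<phi> \<psi> unfolding bilinear_map_def by blast+
  qed (rule eq[OF i])
qed

lemmas br_bilinear = bilinear_mapD[OF bilinear_br]

lemma br_diff: "br u (v - w) = br u v - br u w" "br (u - v) w = br u w - br v w"
  using br_bilinear(1)[of u "v - w" w] br_bilinear(2)[of "u - v" v w] by simp_all

text \<open>Every \<open>x m\<close> with m \<ge> 2 is annihilated by \<open>br u\<close>, so only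
  the \<open>x 1\<close> coordinate of the right argument survives. Brackets in the cocycle identity
  thereby reduce to right multiplication by \<open>x 1\<close>.\<close>

lemma br_eq_scale: "br u v = scale (coord 1 v) (br u (x 1))"
proof (rule linear_eq_on_basis[where f = "br u"])
  show "Vector_Spaces.linear scale scale (\<lambda>v. scale (coord 1 v) (br u (x 1)))"
    unfolding Vector_Spaces.linear_iff using vector_space_axioms
    by (simp add: coord_add coord_scale scale_left_distrib)
  fix m assume m: "m \<in> {1..n}"
  show "br u (x m) = scale (coord 1 (x m)) (br u (x 1))"
    by (cases "m = 1") (use m in \<open>simp_all add: representation_x br_x_ge_2\<close>)
qed (rule linear_br)

lemma br_x_1_eq: "i \<in> {1..n} \<Longrightarrow> br (x i) (x 1) = (if i < n then x (i + 1) else 0)"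
  using br_x_1[of i] br_x_other[of i 1] by auto

lemma coord_br_x_1:
  assumes "i \<in> {1..n}"
  shows "coord i (br u (x 1)) = (if i = 1 then 0 else coord (i - 1) u)"
proof -
  \<comment> \<open>\<open>linear_eq_on_basis\<close> compares maps into the algebra, so both
    scalars are multiplied by the nonzero vector \<open>x 1\<close>, which is cancelled at the
    end.\<close>
  have "scale (coord i (br u (x 1))) (x 1) = scale (if i = 1 then 0 else coord (i - 1) u) (x 1)"
  proof (rule linear_eq_on_basis[where f = "\<lambda>u. scale (coord i (br u (x 1))) (x 1)"])
    fix j assume "j \<in> {1..n}"
    moreover have "i = 1 \<or> i - 1 \<in> {1..n}" using assms by auto
    ultimately show "scale (coord i (br (x j) (x 1))) (x 1)
        = scale (if i = 1 then 0 else coord (i - 1) (x j)) (x 1)"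
      using assms by (auto simp: br_x_1_eq representation_x coord_zero)
  qed (use vector_space_axioms in \<open>simp_all add: Vector_Spaces.linear_iff br_bilinear coord_add
    coord_scale scale_left_distrib\<close>)
  moreover have "x 1 \<noteq> 0"
    using dependent_zero[of "x ` {1..n}"] independent_Basis assms by fastforce
  ultimately show ?thesis by (simp only: scale_cancel_right) blast
qed

section \<open>The maps \<open>phi\<close> and \<open>psi\<close> are cocycles\<close>

lemma phi_eq:
  assumes "j \<in> {1..n}"
  shows "phi scale x n j k u v = scale (coord j u * coord 1 v) (x k)"
proof (rule bilinear_eq_on_basis[where \<phi> = "phi scale x n j k"])
  show "bilinear_map scale (\<lambda>u v. scale (coord j u * coord 1 v) (x k))"
    by (rule bilinear_mapI[OF vector_space_axioms])
      (simp_all add: coord_add coord_scale algebra_simps)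
qed (use assms in \<open>auto simp: phi_def bilinear_map_bilinear_ext bilinear_ext_x representation_x\<close>)

text \<open>Right multiplication by \<open>x 1\<close> sends \<open>x i\<close> to
  \<open>x (i + 1)\<close> for i < n and \<open>x n\<close> to 0. So it encodes the second branch of
  the table of \<open>psi\<close>, including its cutoff at n - 1.\<close>

lemma psi_eq:
  assumes "j \<in> {1..n - 1}"
  shows "psi scale x n j u v
    = scale (coord j u * coord 1 v) (x 1) - scale (coord (j + 1) v) (br u (x 1))"
proof (rule bilinear_eq_on_basis[where \<phi> = "psi scale x n j"])
  show "bilinear_map scale (\<lambda>u v. scale (coord j u * coord 1 v) (x 1)
      - scale (coord (j + 1) v) (br u (x 1)))"
    by (rule bilinear_mapI[OF vector_space_axioms])
      (simp_all add: coord_add coord_scale br_bilinear algebra_simps)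
  fix i m assume "i \<in> {1..n}" "m \<in> {1..n}"
  then show "psi scale x n j (x i) (x m) = scale (coord j (x i) * coord 1 (x m)) (x 1)
      - scale (coord (j + 1) (x m)) (br (x i) (x 1))"
    using assms by (auto simp: psi_def bilinear_ext_x representation_x br_x_1_eq)
qed (simp add: psi_def bilinear_map_bilinear_ext)

text \<open>The term \<open>br u (phi ...)\<close> vanishes because \<open>x k\<close> is a right
  annihilator for k \<ge> 2, and \<open>phi ... u (br v w)\<close> vanishes because brackets have no
  \<open>x 1\<close> coordinate. The other four terms cancel in pairs, being symmetric in
  \<open>v\<close> and \<open>w\<close> up to their signs.\<close>

lemma phi_in_ZL2:
  assumes j: "j \<in> {1..n}" and k: "k \<in> {2..n}"
  shows "phi scale x n j k \<in> ZL2 scale br"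
proof -
  have "coord 1 (x k) = 0" using k by (simp add: representation_x)
  moreover have "coord 1 (br u (x 1)) = 0" for u
    using j by (simp add: coord_br_x_1)
  ultimately have "br u (phi scale x n j k v w) - br (phi scale x n j k u v) w
      + br (phi scale x n j k u w) v + phi scale x n j k u (br v w)
      - phi scale x n j k (br u v) w + phi scale x n j k (br u w) v = 0" for u v w
    by (simp add: phi_eq[OF j] br_eq_scale[of _ v] br_eq_scale[of _ w]
      br_x_ge_2[OF k] coord_scale br_bilinear algebra_simps)
  then show ?thesis
    by (simp add: ZL2_def phi_def bilinear_map_bilinear_ext)
qed

text \<open>Since coordinate j + 1 of \<open>br v (x 1)\<close> is coordinate j of \<open>v\<close>,
  the term \<open>psi ... u (br v w)\<close> cancels \<open>br u (psi ... v w)\<close>. Among the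
  other four terms, the multiples of \<open>x 1\<close> and of \<open>br (x 1) (x 1)\<close> cancel
  by symmetry in \<open>v\<close> and \<open>w\<close>, and the multiples of
  \<open>br (br u (x 1)) (x 1)\<close> cancel between the two pairs.\<close>

lemma psi_in_ZL2:
  assumes j: "j \<in> {1..n - 1}"
  shows "psi scale x n j \<in> ZL2 scale br"
proof -
  have n: "n \<ge> 2" using j by auto
  have "coord 1 (x 1) = 1" using n by (simp add: representation_x)
  moreover have "coord 1 (br u (x 1)) = 0" "coord (j + 1) (br u (x 1)) = coord j u" for u
    using j n by (auto simp: coord_br_x_1)
  ultimately have "br u (psi scale x n j v w) - br (psi scale x n j u v) w
      + br (psi scale x n j u w) v + psi scale x n j u (br v w)
      - psi scale x n j (br u v) w + psi scale x n j (br u w) v = 0" for u v w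
    by (simp add: psi_eq[OF j] br_eq_scale[of _ v] br_eq_scale[of _ w]
      br_br_zero coord_scale coord_diff br_bilinear br_diff algebra_simps)
  then show ?thesis
    by (simp add: ZL2_def psi_def bilinear_map_bilinear_ext)
qed

lemma subspace_ZL2: "module.subspace (map_scale scale) (ZL2 scale br)"
proof -
  interpret V: vector_space "map_scale scale"
    by (rule vector_space_map_scale[OF vector_space_axioms])
  show ?thesis
  proof (rule V.subspaceI)
    show "0 \<in> ZL2 scale br"
      by (auto simp: ZL2_def br_zero intro!: bilinear_mapI[OF vector_space_axioms])
  next
    fix \<phi> \<psi> assume "\<phi> \<in> ZL2 scale br" "\<psi> \<in> ZL2 scale br"
    then have bil: "bilinear_map scale \<phi>" "bilinear_map scale \<psi>"
      and id: "br u (\<phi> v w) - br (\<phi> u v) w + br (\<phi> u w) v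
        + \<phi> u (br v w) - \<phi> (br u v) w + \<phi> (br u w) v = 0"
        "br u (\<psi> v w) - br (\<psi> u v) w + br (\<psi> u w) v
        + \<psi> u (br v w) - \<psi> (br u v) w + \<psi> (br u w) v = 0" for u v w
      by (simp_all add: ZL2_def)
    have "bilinear_map scale (\<phi> + \<psi>)"
      by (rule bilinear_mapI[OF vector_space_axioms])
        (simp_all add: bilinear_mapD[OF bil(1)] bilinear_mapD[OF bil(2)] scale_right_distrib)
    moreover have "br u ((\<phi> + \<psi>) v w) - br ((\<phi> + \<psi>) u v) w + br ((\<phi> + \<psi>) u w) v
        + (\<phi> + \<psi>) u (br v w) - (\<phi> + \<psi>) (br u v) w + (\<phi> + \<psi>) (br u w) v = 0" for u v w
      using arg_cong2[OF id(1)[of u v w] id(2)[of u v w], of "(+)"]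
      by (simp add: br_bilinear algebra_simps)
    ultimately show "\<phi> + \<psi> \<in> ZL2 scale br" by (simp add: ZL2_def)
  next
    fix a \<phi> assume "\<phi> \<in> ZL2 scale br"
    then have bil: "bilinear_map scale \<phi>"
      and id: "br u (\<phi> v w) - br (\<phi> u v) w + br (\<phi> u w) v
        + \<phi> u (br v w) - \<phi> (br u v) w + \<phi> (br u w) v = 0" for u v w
      by (simp_all add: ZL2_def)
    have "bilinear_map scale (map_scale scale a \<phi>)"
      by (rule bilinear_mapI[OF vector_space_axioms])
        (simp_all add: map_scale_def bilinear_mapD[OF bil] scale_right_distrib mult.commute)
    moreover have "br u (map_scale scale a \<phi> v w) - br (map_scale scale a \<phi> u v) w
        + br (map_scale scale a \<phi> u w) v + map_scale scale a \<phi> u (br v w)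
        - map_scale scale a \<phi> (br u v) w + map_scale scale a \<phi> (br u w) v = 0" for u v w
      using arg_cong[OF id[of u v w], of "scale a"]
      by (simp add: map_scale_def br_bilinear scale_right_distrib scale_right_diff_distrib)
    ultimately show "map_scale scale a \<phi> \<in> ZL2 scale br" by (simp add: ZL2_def)
  qed
qed

section \<open>Cocycles with vanishing coordinates\<close>

lemma ZL2_eq_0:
  assumes \<phi>: "\<phi> \<in> ZL2 scale br" and n: "n \<ge> 2"
    and c: "\<And>j k. j \<in> {1..n} \<Longrightarrow> k \<in> {2..n} \<Longrightarrow> coord k (\<phi> (x j) (x 1)) = 0"
    and c1: "\<And>j. j \<in> {1..n - 1} \<Longrightarrow> coord 1 (\<phi> (x j) (x 1)) = 0"
  shows "\<phi> = 0"
proof -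
  have bil: "bilinear_map scale \<phi>"
    and id: "br u (\<phi> v w) - br (\<phi> u v) w + br (\<phi> u w) v
        + \<phi> u (br v w) - \<phi> (br u v) w + \<phi> (br u w) v = 0" for u v w
    using \<phi> by (simp_all add: ZL2_def)
  have zero: "\<phi> u 0 = 0" "\<phi> 0 u = 0" for u
    using bilinear_mapD(1)[OF bil, of u 0 0] bilinear_mapD(2)[OF bil, of 0 0 u] by simp_all
  \<comment> \<open>The four dropped terms of the identity are together antisymmetric in
    \<open>v\<close> and \<open>w\<close>.\<close>
  have id2: "br u (\<phi> v w) + br u (\<phi> w v) + \<phi> u (br v w) + \<phi> u (br w v) = 0" for u v w
    using arg_cong2[OF id[of u v w] id[of u w v], of "(+)"] by (simp add: algebra_simps)
  \<comment> \<open>The left argument \<open>u\<close> stays arbitrary because the induction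
    hypothesis is also needed at \<open>x 1\<close>, to remove
    \<open>\<phi> (x 1) (x (Suc m))\<close>. The bound m < n keeps the index within the range of
    \<open>c1\<close>.\<close>
  have step: "\<phi> u (x (m + 1)) = 0" if "1 \<le> m" "m < n" for u m
    using that
  proof (induction m arbitrary: u rule: dec_induct)
    case base
    have "\<phi> u (x 2) = - br u (\<phi> (x 1) (x 1))"
      using id[of u "x 1" "x 1"] br_x_1_eq[of 1] n by (simp add: add_eq_0_iff)
    also have "\<dots> = 0"
      using c1[of 1] n by (simp add: br_eq_scale[of u "\<phi> _ _"])
    finally show ?case by simp
  next
    case (step m)
    have "br (x (Suc m)) (x 1) = x (Suc m + 1)" "br (x 1) (x (Suc m)) = 0"
      using step.prems step.hyps by (simp_all add: br_x_1_eq br_x_ge_2)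
    moreover have "\<phi> (x 1) (x (Suc m)) = 0"
      using step.IH[of "x 1"] step.prems by (simp only: Suc_eq_plus1)
    moreover have "br u (\<phi> (x (Suc m)) (x 1)) = 0"
      using c1[of "Suc m"] step.prems by (simp add: br_eq_scale[of u "\<phi> _ _"])
    ultimately show ?case
      using id2[of u "x 1" "x (Suc m)"] by (simp add: zero br_zero)
  qed
  have ge_2: "\<phi> u (x m) = 0" if "m \<in> {2..n}" for u m
    using step[of "m - 1" u] that by auto
  \<comment> \<open>The coordinate not covered by \<open>c\<close> and \<open>c1\<close>. At the
    last index \<open>br (x n) (x 1)\<close> is 0, so \<open>id2\<close> yields no new value of
    \<open>\<phi>\<close> but a constraint. The left argument \<open>x 1\<close> is chosen because
    \<open>br (x 1) (x 1)\<close> is \<open>x 2\<close>, which is nonzero.\<close>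
  have "br (x 1) (\<phi> (x n) (x 1)) = 0"
    using id2[of "x 1" "x 1" "x n"] n br_x_1_eq[of n]
    by (simp add: ge_2 br_x_ge_2 br_zero zero)
  then have "scale (coord 1 (\<phi> (x n) (x 1))) (x 2) = 0"
    using n br_x_1_eq[of 1] by (simp add: br_eq_scale[of "x 1" "\<phi> _ _"])
  moreover have "x 2 \<noteq> 0"
    using dependent_zero[of "x ` {1..n}"] independent_Basis n by fastforce
  ultimately have c1n: "coord 1 (\<phi> (x n) (x 1)) = 0" by simp
  have x_1: "\<phi> (x j) (x 1) = 0" if "j \<in> {1..n}" for j
  proof (rule eq_0_if_coords_0)
    fix k assume "k \<in> {1..n}"
    then show "coord k (\<phi> (x j) (x 1)) = 0"
      using that c[of j k] c1[of j] c1n by (cases "k = 1"; cases "j = n") auto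
  qed
  have "\<phi> u v = 0" for u v
  proof (rule bilinear_eq_on_basis[OF bil, where \<psi> = "\<lambda>u v. 0"])
    show "bilinear_map scale (\<lambda>u v. 0)"
      by (rule bilinear_mapI[OF vector_space_axioms]) simp_all
    fix i m assume "i \<in> {1..n}" "m \<in> {1..n}"
    then show "\<phi> (x i) (x m) = 0"
      by (cases "m = 1") (auto simp: x_1 intro!: ge_2)
  qed
  then show ?thesis by (simp add: fun_eq_iff)
qed

section \<open>Duality and the basis\<close>

lemma phi_x: "j \<in> {1..n} \<Longrightarrow> i \<in> {1..n} \<Longrightarrow> phi scale x n j k (x i) (x 1) = (if i = j then x k else 0)"
  by (simp add: phi_def bilinear_ext_x)

lemma psi_x:
  "j \<in> {1..n - 1} \<Longrightarrow> i \<in> {1..n} \<Longrightarrow> psi scale x n j (x i) (x 1) = (if i = j then x 1 else 0)"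
  by (auto simp: psi_def bilinear_ext_x)

lemma linear_coord_eval: "Vector_Spaces.linear (map_scale scale) (*) (\<lambda>\<phi>. coord k (\<phi> u v))"
proof -
  have "vector_space ((*) :: 'f \<Rightarrow> 'f \<Rightarrow> 'f)"
    by unfold_locales (simp_all add: algebra_simps)
  then show ?thesis
    unfolding Vector_Spaces.linear_iff
    by (simp add: vector_space_map_scale[OF vector_space_axioms] coord_add coord_scale)
      (simp add: map_scale_def coord_scale)
qed

text \<open>The functionals read coordinates of \<open>\<phi> (x j) (x 1)\<close> only: at
  \<open>x k\<close> with k \<ge> 2 for \<open>phi\<close>, at \<open>x 1\<close> for
  \<open>psi\<close>. The values of \<open>psi\<close> at right argument \<open>x (j + 1)\<close>
  are invisible to them, as j + 1 \<ge> 2, so duality is immediate; \<open>ZL2_eq_0\<close> supplies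
  the trivial common kernel.\<close>

lemma family_basis_ZL2:
  assumes n: "n \<ge> 2"
  shows "family_basis (map_scale scale) (({1..n} \<times> {2..n}) <+> {1..n - 1})
    (case_sum (\<lambda>(j, k). phi scale x n j k) (\<lambda>j. psi scale x n j)) (ZL2 scale br)"
proof (rule family_basis_dual[where
      \<delta> = "case_sum (\<lambda>(j, k) \<phi>. coord k (\<phi> (x j) (x 1))) (\<lambda>j \<phi>. coord 1 (\<phi> (x j) (x 1)))"])
  fix \<phi>
  assume "\<phi> \<in> ZL2 scale br" and \<delta>: "\<And>i. i \<in> ({1..n} \<times> {2..n}) <+> {1..n - 1} \<Longrightarrow>
    case_sum (\<lambda>(j, k) \<phi>. coord k (\<phi> (x j) (x 1))) (\<lambda>j \<phi>. coord 1 (\<phi> (x j) (x 1))) i \<phi> = 0"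
  moreover have "coord k (\<phi> (x j) (x 1)) = 0" if "j \<in> {1..n}" "k \<in> {2..n}" for j k
    using \<delta>[of "Inl (j, k)"] that by (simp add: Plus_def)
  moreover have "coord 1 (\<phi> (x j) (x 1)) = 0" if "j \<in> {1..n - 1}" for j
    using \<delta>[of "Inr j"] that by (simp add: Plus_def)
  ultimately show "\<phi> = 0"
    using n by (intro ZL2_eq_0) auto
next
  fix p q assume "p \<in> ({1..n} \<times> {2..n}) <+> {1..n - 1}" "q \<in> ({1..n} \<times> {2..n}) <+> {1..n - 1}"
  then show "case_sum (\<lambda>(j, k) \<phi>. coord k (\<phi> (x j) (x 1))) (\<lambda>j \<phi>. coord 1 (\<phi> (x j) (x 1))) p
      (case_sum (\<lambda>(j, k). phi scale x n j k) (\<lambda>j. psi scale x n j) q) = (if p = q then 1 else 0)"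
    by (elim PlusE) (auto simp: phi_x psi_x representation_x coord_zero split: if_splits)
next
  fix p assume p: "p \<in> ({1..n} \<times> {2..n}) <+> {1..n - 1}"
  show "case_sum (\<lambda>(j, k). phi scale x n j k) (\<lambda>j. psi scale x n j) p \<in> ZL2 scale br"
    using p by (elim PlusE) (clarsimp simp: phi_in_ZL2, simp add: psi_in_ZL2)
  show "Vector_Spaces.linear (map_scale scale) (*)
      (case_sum (\<lambda>(j, k) \<phi>. coord k (\<phi> (x j) (x 1))) (\<lambda>j \<phi>. coord 1 (\<phi> (x j) (x 1))) p)"
    using p by (elim PlusE) (clarsimp simp: linear_coord_eval, simp add: linear_coord_eval)
qed (simp_all add: vector_space_map_scale[OF vector_space_axioms] subspace_ZL2)

end

theorem proposition3p1:
  fixes scale :: "'f::field_char_0 \<Rightarrow> 'v::ab_group_add \<Rightarrow> 'v"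
    and x :: "nat \<Rightarrow> 'v" and n :: nat and br :: "'v \<Rightarrow> 'v \<Rightarrow> 'v"
  assumes "null_filiform scale x n br"
    and "n \<ge> 2"
  shows "family_basis (map_scale scale)
    (({1..n} \<times> {2..n}) <+> {1..n - 1})
    (case_sum (\<lambda>(j, k). phi scale x n j k) (\<lambda>j. psi scale x n j))
    (ZL2 scale br)"
  using assms by (rule null_filiform.family_basis_ZL2)

end
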